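(* For any $k\in\{1,\dots,n-1\}$ and any (possibly randomized) query algorithm $\mathcal{A}$, there exist a monotone function $f:\{0,1\}^n\to\{0,1\}$ and an input $x^{\star}\in\{0,1\}^n$ with $C(f,x^{\star})=k$ such that $\mathcal{A}$ must make at least $\frac{1}{2}\binom{n}{k}$ queries to $f$ in order to find a size-$k$ certificate for $f$ at $x^{\star}$ with probability at least $\frac12$.
   Context: $f$ is monotone if $x\le y$ coordinatewise implies $f(x)\le f(y)$. For $x\in\{0,1\}^n$ and $S\subseteq[n]$, $x|_S$ is the restriction of $x$ to coordinates in $S$. A set $S\subseteq[n]$ is a certificate for $f$ at $x^{\star}$ if every $y\in\{0,1\}^n$ with $y|_S=x^{\star}|_S$ satisfies $f(y)=f(x^{\star})$, and $C(f,x^{\star})$ is the minimum size of such a certificate. A query algorithm accesses $f$ only through queries: it chooses $y\in\{0,1\}^n$ and receives $f(y)$.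
   Formalization: The bound ½·binom(n,k) is proved when "find" means the query answers establish the output as a size-k certificate; if any correct output counts, even a lucky guess, the bound is lower by one query, as the stated one fails (n=2, k=1: a random singleton, no queries). *)

theory Defs
  imports "HOL-Probability.Probability"
begin

text \<open>
  The index set $[n]$ is a finite type \<open>'n\<close> with \<open>CARD('n)\<close> $= n$, and $\{0,1\}$ is \<^typ>\<open>bool\<close>.
  The pointwise order on functions makes \<^const>\<open>mono\<close> the coordinatewise notion of monotonicity.
\<close>

type_synonym 'n point = "'n \<Rightarrow> bool"
type_synonym 'n boolfun = "'n point \<Rightarrow> bool"

definition certificate :: "'n boolfun \<Rightarrow> 'n point \<Rightarrow> 'n set \<Rightarrow> bool" where
  "certificate f x S \<longleftrightarrow> (\<forall>y. restrict y S = restrict x S \<longrightarrow> f y = f x)"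

definition cert_complexity :: "('n::finite) boolfun \<Rightarrow> 'n point \<Rightarrow> nat" where
  "cert_complexity f x = Min (card ` {S. certificate f x S})"

text \<open>
  A strategy is a query algorithm whose internal coins (and input) have been fixed: from the
  queries made so far and their answers it determines either the next query or the final output.
  It need not terminate.
\<close>

datatype 'n action = Query "'n point" | Output "'n set"

type_synonym 'n history = "('n point \<times> bool) list"
type_synonym 'n strategy = "'n history \<Rightarrow> 'n action"

text \<open>
  \<open>run \<sigma> f q h\<close> continues from history \<open>h\<close> with at most \<open>q\<close> further queries to \<open>f\<close>; the result is
  \<^const>\<open>None\<close> if no output has been produced when the strategy asks for one more query.
\<close>

primrec run :: "'n strategy \<Rightarrow> 'n boolfun \<Rightarrow> nat \<Rightarrow> 'n history \<Rightarrow> ('n history \<times> 'n set) option" where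
  "run \<sigma> f 0 h = (case \<sigma> h of Output S \<Rightarrow> Some (h, S) | Query y \<Rightarrow> None)"
| "run \<sigma> f (Suc q) h =
     (case \<sigma> h of Output S \<Rightarrow> Some (h, S) | Query y \<Rightarrow> run \<sigma> f q (h @ [(y, f y)]))"

text \<open>
  A randomized algorithm draws its coins \<open>\<omega>\<close> from an arbitrary probability space and receives the
  input \<open>x\<close>, at which a certificate is sought, explicitly.
\<close>

type_synonym ('w, 'n) query_alg = "'w \<Rightarrow> 'n point \<Rightarrow> 'n strategy"

definition randomized_query_alg :: "'w measure \<Rightarrow> ('w, 'n) query_alg \<Rightarrow> bool" where
  "randomized_query_alg M A \<longleftrightarrow>
     prob_space M \<and> (\<forall>x h. (\<lambda>\<omega>. A \<omega> x h) \<in> measurable M (count_space UNIV))"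

definition outputs_certificate ::
    "'n strategy \<Rightarrow> 'n boolfun \<Rightarrow> 'n point \<Rightarrow> nat \<Rightarrow> nat \<Rightarrow> bool" where
  "outputs_certificate \<sigma> f x k q \<longleftrightarrow>
     (\<exists>h S. run \<sigma> f q [] = Some (h, S) \<and> certificate f x S \<and> card S = k)"

text \<open>
  Finding a certificate, as opposed to guessing one: the output is a size-\<open>k\<close> certificate, and the
  answers received establish this, given the promise that the function is monotone
  and has certificate complexity \<open>k\<close> at \<open>x\<close>.  If unsupported guesses also counted, then the bound
  of $\frac12\binom{n}{k}$ queries would be too large by one query: for \<open>n = 2\<close> and \<open>k = 1\<close>,
  outputting a uniformly random singleton is correct with probability at least one half and
  makes no query at all.  (In general, untested candidates can be guessed in the same way; such
  outputs count in \<^const>\<open>outputs_certificate\<close>, with the guess charged as one extra query in the bound.)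
\<close>

definition finds_certificate ::
    "('n::finite) strategy \<Rightarrow> 'n boolfun \<Rightarrow> 'n point \<Rightarrow> nat \<Rightarrow> nat \<Rightarrow> bool" where
  "finds_certificate \<sigma> f x k q \<longleftrightarrow>
     (\<exists>h S. run \<sigma> f q [] = Some (h, S) \<and> certificate f x S \<and> card S = k \<and>
        (\<forall>g. mono g \<longrightarrow> cert_complexity g x = k \<longrightarrow> (\<forall>(y, b) \<in> set h. g y = b) \<longrightarrow>
           certificate g x S))"

end

theory Submission
  imports Defs
begin

text \<open>
  Let \<open>x\<close> be the all-ones point and hide a uniformly random \<open>k\<close>-set \<open>S\<close>: the function accepts
  a point iff its support is \<open>S\<close> or has more than \<open>k\<close> elements, so that \<open>S\<close> is the only
  \<open>k\<close>-certificate at \<open>x\<close>.  Every query other than \<open>S\<close> itself is answered independently of \<open>S\<close>.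
  Hence, for fixed coins, an algorithm can only succeed on those \<open>S\<close> which it queries or outputs
  when run against the plain threshold function, and it examines at most one new set per step;
  averaging over \<open>S\<close> and the coins gives the bound.
\<close>

section \<open>Certificates of the hidden-set function at the all-ones point\<close>

definition hidden_fun :: "nat \<Rightarrow> ('n::finite) set \<Rightarrow> 'n boolfun" where
  "hidden_fun k S y \<longleftrightarrow> Collect y = S \<or> k < card (Collect y)"

lemma mono_hidden_fun:
  fixes S :: "'n::finite set"
  assumes "card S = k"
  shows "mono (hidden_fun k S)"
proof (rule monoI)
  fix y z :: "'n point"
  assume "y \<le> z"
  then have sub: "Collect y \<subseteq> Collect z"
    by auto
  have "card (Collect y) < card (Collect z)" if "Collect y \<noteq> Collect z"
    using that sub by (intro psubset_card_mono) auto
  then show "hidden_fun k S y \<le> hidden_fun k S z"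
    using assms by (cases "Collect y = Collect z") (auto simp: hidden_fun_def)
qed

text \<open>The indicator of \<open>T\<close> is the least point that agrees with the all-ones point
  on \<open>T\<close>, so by monotonicity its value alone decides the matter.\<close>

lemma certificate_top_iff:
  fixes f :: "('n::finite) boolfun"
  assumes "mono f" "f (\<lambda>_. True)"
  shows "certificate f (\<lambda>_. True) T \<longleftrightarrow> f (\<lambda>i. i \<in> T)"
proof
  have "restrict (\<lambda>i. i \<in> T) T = restrict (\<lambda>_. True) T"
    by (auto simp: restrict_def)
  then show "f (\<lambda>i. i \<in> T)" if "certificate f (\<lambda>_. True) T"
    using that assms(2) by (auto simp: certificate_def)
next
  assume T: "f (\<lambda>i. i \<in> T)"
  have "f y" if "restrict y T = restrict (\<lambda>_. True) T" for y
  proof -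
    have "y i" if "i \<in> T" for i
      using fun_cong[OF \<open>restrict y T = _\<close>, of i] that by simp
    then have "(\<lambda>i. i \<in> T) \<le> y"
      by (auto simp: le_fun_def)
    then show ?thesis
      using monoD[OF assms(1), of "\<lambda>i. i \<in> T" y] T by simp
  qed
  then show "certificate f (\<lambda>_. True) T"
    using assms(2) by (simp add: certificate_def)
qed

lemma certificate_hidden_fun:
  fixes S :: "'n::finite set"
  assumes "card S = k"
  shows "certificate (hidden_fun k S) (\<lambda>_. True) T \<longleftrightarrow> T = S \<or> k < card T"
proof -
  \<comment> \<open>The all-ones point is accepted in either case: for \<open>S = UNIV\<close> its
    support is \<open>S\<close>, otherwise its support has more than \<open>k\<close>
    elements.\<close>
  have "card S < CARD('n)" if "S \<noteq> UNIV"
    using that by (intro psubset_card_mono) auto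
  then have "hidden_fun k S (\<lambda>_. True)"
    using assms by (auto simp: hidden_fun_def)
  then show ?thesis
    using certificate_top_iff[OF mono_hidden_fun[OF assms]] by (simp add: hidden_fun_def)
qed

lemma cert_complexity_hidden_fun:
  assumes "card S = k"
  shows "cert_complexity (hidden_fun k S) (\<lambda>_. True) = k"
  unfolding cert_complexity_def certificate_hidden_fun[OF assms]
  using assms by (intro Min_eqI) auto

section \<open>Runs against the hidden-set function and the sets they examine\<close>

lemma run_answers:
  assumes "run \<sigma> f q h = Some (h', T)" "\<forall>(y, b) \<in> set h. f y = b"
  shows "\<forall>(y, b) \<in> set h'. f y = b"
  using assms by (induction q arbitrary: h) (auto split: action.splits)

lemma length_run:
  assumes "run \<sigma> f q h = Some (h', T)"
  shows "length h' \<le> length h + q"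
  using assms by (induction q arbitrary: h) (force split: action.splits)+

text \<open>
  Producing an output counts as a step: this is the one extra query charged to a guess.
\<close>

primrec tried :: "nat \<Rightarrow> ('n::finite) strategy \<Rightarrow> nat \<Rightarrow> 'n history \<Rightarrow> 'n set set" where
  "tried k \<sigma> 0 h = {}"
| "tried k \<sigma> (Suc q) h =
     (case \<sigma> h of Output S \<Rightarrow> {S}
      | Query y \<Rightarrow> insert (Collect y) (tried k \<sigma> q (h @ [(y, k < card (Collect y))])))"

lemma card_tried: "finite (tried k \<sigma> q h) \<and> card (tried k \<sigma> q h) \<le> q"
proof (induction q arbitrary: h)
  case (Suc q)
  then show ?case
    by (auto split: action.splits intro: order_trans[OF card_insert_le_m1])
qed simp

lemma tried_mono: "q \<le> q' \<Longrightarrow> tried k \<sigma> q h \<subseteq> tried k \<sigma> q' h"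
proof (induction q arbitrary: q' h)
  case (Suc q)
  obtain r where r: "q' = Suc r" "q \<le> r"
    using Suc.prems by (cases q') auto
  show ?case
    using Suc.IH[OF r(2)] r(1) by (auto split: action.splits)
qed simp

text \<open>Until \<open>S\<close> is queried, \<open>hidden_fun k S\<close> answers like the
  threshold function, so the run and \<open>tried\<close> share their history; once \<open>S\<close>
  is queried, it has been collected. The budget \<open>Suc q\<close> leaves room for the
  output.\<close>

lemma run_output_tried:
  assumes "run \<sigma> (hidden_fun k S) q h = Some (h', S)"
  shows "S \<in> tried k \<sigma> (Suc q) h"
  using assms
proof (induction q arbitrary: h)
  case (Suc q)
  show ?case
  proof (cases "\<sigma> h")
    case (Query y)
    then show ?thesis
      using Suc.prems Suc.IH[of "h @ [(y, k < card (Collect y))]"]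
      by (cases "Collect y = S") (auto simp: hidden_fun_def)
  qed (use Suc.prems in auto)
qed (auto split: action.splits)

text \<open>The same comparison of histories, but a queried set needs no output step, hence the
  budget \<open>q\<close>. The second alternative makes the induction work for a nonempty initial
  history.\<close>

lemma run_query_tried:
  assumes "run \<sigma> (hidden_fun k S) q h = Some (h', T)"
    and "S \<in> Collect ` fst ` set h'"
  shows "S \<in> tried k \<sigma> q h \<or> S \<in> Collect ` fst ` set h"
  using assms
proof (induction q arbitrary: h)
  case (Suc q)
  show ?case
  proof (cases "\<sigma> h")
    case (Query y)
    then show ?thesis
      using Suc.prems Suc.IH[of "h @ [(y, k < card (Collect y))]"]
      by (cases "Collect y = S") (auto simp: hidden_fun_def)
  qed (use Suc.prems in auto)
qed (auto split: action.splits)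

lemma outputs_certificate_tried:
  assumes "card S = k" "outputs_certificate \<sigma> (hidden_fun k S) (\<lambda>_. True) k q"
  shows "S \<in> tried k \<sigma> (Suc q) []"
  using assms run_output_tried
  by (force simp: outputs_certificate_def certificate_hidden_fun)

text \<open>If \<open>S\<close> was never queried, some other unqueried \<open>k\<close>-set
  explains the same answers, and \<open>S\<close> is no certificate for it; so the answers cannot
  establish the output.\<close>

lemma finds_certificate_tried:
  fixes S :: "'n::finite set"
  assumes "card S = k" "finds_certificate \<sigma> (hidden_fun k S) (\<lambda>_. True) k q"
    and q: "q + 2 \<le> CARD('n) choose k"
  shows "S \<in> tried k \<sigma> q []"
proof -
  obtain h T where run: "run \<sigma> (hidden_fun k S) q [] = Some (h, T)"
    and T: "certificate (hidden_fun k S) (\<lambda>_. True) T" "card T = k"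
    and proves: "\<And>g. mono g \<Longrightarrow> cert_complexity g (\<lambda>_. True) = k \<Longrightarrow>
      \<forall>(y, b) \<in> set h. g y = b \<Longrightarrow> certificate g (\<lambda>_. True) T"
    using assms(2) unfolding finds_certificate_def by blast
  have TS: "T = S"
    using T assms(1) by (simp add: certificate_hidden_fun)
  have "S \<in> Collect ` fst ` set h"
  proof (rule ccontr)
    assume S: "S \<notin> Collect ` fst ` set h"
    \<comment> \<open>At most \<open>q\<close> queried sets together with \<open>S\<close> itself
      make at most \<open>q + 1\<close> sets, so \<open>q + 2\<close> many \<open>k\<close>-sets
      guarantee another candidate \<open>S'\<close>.\<close>
    define B where "B = insert S (Collect ` fst ` set h)"
    have "card (Collect ` fst ` set h) \<le> length h"
      by (metis card_image_le card_length finite_imageI finite_set le_trans)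
    then have "card B \<le> Suc q"
      using length_run[OF run] by (simp add: B_def card_insert_if)
    moreover have "card {S :: 'n set. card S = k} = CARD('n) choose k"
      using n_subsets[of "UNIV :: 'n set" k] by simp
    ultimately have "\<not> {S. card S = k} \<subseteq> B"
      using q card_mono[of B "{S. card S = k}"] by auto
    then obtain S' where S': "card S' = k" "S' \<noteq> S" "S' \<notin> Collect ` fst ` set h"
      by (auto simp: B_def)
    have "hidden_fun k S y = b" if "(y, b) \<in> set h" for y b
      using run_answers[OF run] that by auto
    \<comment> \<open>The two functions can differ only at points with support \<open>S\<close> or
      \<open>S'\<close>, and neither was queried.\<close>
    moreover have "hidden_fun k S' y = hidden_fun k S y" if "(y, b) \<in> set h" for y b
    proof -
      have "Collect y \<in> Collect ` fst ` set h"
        using that by (metis fst_conv imageI)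
      then show ?thesis
        using S S'(3) by (auto simp: hidden_fun_def)
    qed
    ultimately have "\<forall>(y, b) \<in> set h. hidden_fun k S' y = b"
      by auto
    then have "certificate (hidden_fun k S') (\<lambda>_. True) S"
      using proves TS S'(1) mono_hidden_fun cert_complexity_hidden_fun by blast
    then show False
      using S' assms(1) by (simp add: certificate_hidden_fun)
  qed
  then show ?thesis
    using run_query_tried[OF run] by simp
qed

section \<open>Measurability and averaging over the coins\<close>

lemma tried_measurable:
  fixes A :: "('w, 'n::finite) query_alg"
  assumes "randomized_query_alg M A"
  shows "{\<omega> \<in> space M. S \<in> tried k (A \<omega> x) q h} \<in> sets M"
proof (induction q arbitrary: h)
  case (Suc q)
  have [measurable]: "(\<lambda>\<omega>. A \<omega> x h) \<in> measurable M (count_space UNIV)"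
    using assms by (simp add: randomized_query_alg_def)
  have [measurable]: "Measurable.pred M (\<lambda>\<omega>. S \<in> tried k (A \<omega> x) q h')" for h'
    using Suc by (simp add: pred_def)
  \<comment> \<open>Unfolding one step leaves a union over the finitely many points \<open>y\<close>
    of events that are measurable by the assumption on \<open>A\<close> or by induction.\<close>
  have "S \<in> tried k (A \<omega> x) (Suc q) h \<longleftrightarrow> A \<omega> x h = Output S \<or>
      (\<exists>y. A \<omega> x h = Query y \<and>
        (Collect y = S \<or> S \<in> tried k (A \<omega> x) q (h @ [(y, k < card (Collect y))])))" for \<omega>
    by (auto split: action.splits)
  then show ?case
    by (simp del: tried.simps) measurable
qed simp

text \<open>Double counting: after exchanging sum and expectation, each outcome of the coins
  contributes the number of members of \<open>F\<close> that were tried, at most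
  \<open>q\<close>.\<close>

lemma sum_prob_tried:
  fixes A :: "('w, 'n::finite) query_alg"
  assumes "randomized_query_alg M A"
  shows "(\<Sum>S\<in>F. \<P>(\<omega> in M. S \<in> tried k (A \<omega> x) q h)) \<le> q"
proof -
  interpret prob_space M
    using assms by (simp add: randomized_query_alg_def)
  define E where "E S = {\<omega> \<in> space M. S \<in> tried k (A \<omega> x) q h}" for S
  have [measurable]: "E S \<in> sets M" for S
    unfolding E_def by (rule tried_measurable[OF assms])
  have [simp]: "finite F"
    by simp
  have "(\<Sum>S\<in>F. prob (E S)) = (\<Sum>S\<in>F. expectation (indicator (E S)))"
    by simp
  also have "\<dots> = expectation (\<lambda>\<omega>. \<Sum>S\<in>F. indicator (E S) \<omega>)"
    by (subst Bochner_Integration.integral_sum) (auto simp: emeasure_eq_measure)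
  also have "\<dots> \<le> expectation (\<lambda>_. real q)"
  proof (rule integral_mono)
    fix \<omega> assume "\<omega> \<in> space M"
    then have "(\<Sum>S\<in>F. indicator (E S) \<omega> :: real) = card (F \<inter> tried k (A \<omega> x) q h)"
      by (simp add: E_def indicator_def sum.If_cases Int_def)
    also have "\<dots> \<le> card (tried k (A \<omega> x) q h)"
      using card_tried by (simp add: card_mono)
    also have "\<dots> \<le> q"
      using card_tried by simp
    finally show "(\<Sum>S\<in>F. indicator (E S) \<omega> :: real) \<le> q"
      by simp
  qed (auto simp: emeasure_eq_measure)
  finally show ?thesis
    by (simp add: E_def prob_space)
qed

theorem theorem5p1:
  fixes k :: nat
    and M :: "'w measure"
    and A :: "('w, 'n::finite) query_alg"
  assumes "k \<in> {1..CARD('n) - 1}"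
    and "randomized_query_alg M A"
  shows "\<exists>(f :: 'n boolfun) (x :: 'n point). mono f \<and> cert_complexity f x = k \<and>
    (\<forall>q. \<P>(\<omega> in M. finds_certificate (A \<omega> x) f x k q) \<ge> 1 / 2 \<longrightarrow>
       real q \<ge> 1 / 2 * real (CARD('n) choose k)) \<and>
    (\<forall>q. \<P>(\<omega> in M. outputs_certificate (A \<omega> x) f x k q) \<ge> 1 / 2 \<longrightarrow>
       real (q + 1) \<ge> 1 / 2 * real (CARD('n) choose k))"
proof -
  interpret prob_space M
    using assms(2) by (simp add: randomized_query_alg_def)
  define N where "N = CARD('n) choose k"
  \<comment> \<open>The largest step budget strictly below \<open>N / 2\<close>.\<close>
  define m where "m = (N - 1) div 2"
  define P where "P S = \<P>(\<omega> in M. S \<in> tried k (A \<omega> (\<lambda>_. True)) m [])" for S :: "'n set"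
  have card: "card {S :: 'n set. card S = k} = N"
    using n_subsets[of "UNIV :: 'n set" k] by (simp add: N_def)
  \<comment> \<open>Pascal's rule writes \<open>N\<close> as a sum of two binomial coefficients,
    both positive because 0 < \<open>k\<close> < \<open>CARD('n)\<close>.\<close>
  obtain n j where "CARD('n) = Suc n" "k = Suc j" "j \<le> n" "Suc j \<le> n"
    using assms(1) by (cases "CARD('n)"; cases k) auto
  then have N: "N \<ge> 2"
    using zero_less_binomial[of j n] zero_less_binomial[of "Suc j" n]
    by (simp add: N_def del: zero_less_binomial_iff)
  \<comment> \<open>Otherwise the \<open>N\<close> probabilities would add up to at least
    \<open>N / 2\<close>, exceeding the bound \<open>m\<close>.\<close>
  have "\<exists>S. card S = k \<and> P S < 1 / 2"
  proof (rule ccontr)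
    assume "\<not> ?thesis"
    then have "(\<Sum>S | card (S :: 'n set) = k. 1 / 2) \<le> (\<Sum>S | card S = k. P S)"
      by (intro sum_mono) (auto simp: not_less)
    also have "\<dots> \<le> m"
      unfolding P_def by (rule sum_prob_tried[OF assms(2)])
    finally have "real N / 2 \<le> m"
      using card by simp
    then show False
      using N by (simp add: m_def)
  qed
  then obtain S where S: "card S = k" "P S < 1 / 2"
    by blast
  have small: "\<P>(\<omega> in M. Q \<omega>) < 1 / 2"
    if "\<And>\<omega>. Q \<omega> \<Longrightarrow> S \<in> tried k (A \<omega> (\<lambda>_. True)) r []" "r \<le> m" for Q r
  proof -
    \<comment> \<open>Monotonicity of the measure asks for measurability of the larger event, which
      \<open>tried_measurable\<close> supplies.\<close>
    have "\<P>(\<omega> in M. Q \<omega>) \<le> P S"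
      unfolding P_def using that tried_mono[of r m]
      by (intro finite_measure_mono tried_measurable[OF assms(2)]) blast
    then show ?thesis
      using S(2) by simp
  qed
  have "real N / 2 \<le> q"
    if "\<P>(\<omega> in M. finds_certificate (A \<omega> (\<lambda>_. True)) (hidden_fun k S) (\<lambda>_. True) k q) \<ge> 1 / 2"
    for q
  proof (rule ccontr)
    assume "\<not> ?thesis"
    then have "2 * q < N"
      by simp
    \<comment> \<open>For \<open>q = 0\<close> the second inequality is exactly
      \<open>N \<ge> 2\<close>; for positive \<open>q\<close> it follows from
      \<open>2 * q < N\<close>.\<close>
    then have "q \<le> m" "q + 2 \<le> N"
      using N by (auto simp: m_def)
    then have "\<P>(\<omega> in M. finds_certificate (A \<omega> (\<lambda>_. True)) (hidden_fun k S) (\<lambda>_. True) k q) < 1 / 2"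
      by (intro small[of _ q] finds_certificate_tried[OF S(1)]) (simp_all add: N_def)
    then show False
      using that by linarith
  qed
  moreover have "real N / 2 \<le> real (q + 1)"
    if "\<P>(\<omega> in M. outputs_certificate (A \<omega> (\<lambda>_. True)) (hidden_fun k S) (\<lambda>_. True) k q) \<ge> 1 / 2"
    for q
  proof (rule ccontr)
    assume "\<not> ?thesis"
    then have "2 * Suc q < N"
      by simp
    \<comment> \<open>The guess takes one step beyond the \<open>q\<close> queries, so
      \<open>Suc q\<close> has to fit into the budget.\<close>
    then have "Suc q \<le> m"
      by (auto simp: m_def)
    then have "\<P>(\<omega> in M. outputs_certificate (A \<omega> (\<lambda>_. True)) (hidden_fun k S) (\<lambda>_. True) k q) < 1 / 2"
      by (intro small[of _ "Suc q"] outputs_certificate_tried[OF S(1)])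
    then show False
      using that by linarith
  qed
  ultimately show ?thesis
    using mono_hidden_fun[OF S(1)] cert_complexity_hidden_fun[OF S(1)]
    by (intro exI[of _ "hidden_fun k S"] exI[of _ "\<lambda>_. True"]) (simp add: N_def)
qed

end
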